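(* Let $n\ge1$, let $C$ be the vector space with basis $c_1,\dots,c_n$, and for $i=1,\dots,n$ put $V_i=\langle c_i\rangle\subset C$ and $W_i=\langle c_1,\dots,c_{i-1},c_{i+1}-c_i,\dots,c_n-c_i\rangle\subset C$. Then the Kirkman--Kuzmanovich algebra $KK_n$ is an algebra of type $R_{\mathfrak F}$ for the family $\mathfrak F=\{V_1,W_1;\ldots;V_n,W_n\}$; that is, $\mathfrak F$ satisfies Property (G) and $KK_n\cong R_{\mathfrak F}$.
   Context: $\Bbbk$ is an infinite field. $Q_{p,q}$ is the quiver with vertices $1,2$, with $p$ arrows $c_1,\dots,c_p$ from $1$ to $2$ and $q$ arrows $b_1,\dots,b_q$ from $2$ to $1$; paths are composed right to left. **Kirkman--Kuzmanovich algebras.** For $n\ge1$, $KK_n=\Bbbk Q_{n,n}/J_n$, where $J_n$ is generated by: i) $b_icb_j$ for any $c\in C=\langle c_1,\dots,c_n\rangle$ and all $1\le i,j\le n$; ii) $b_ic_i$ for $1\le i\le n$; iii) $c_jb_i$ for $j<i$; iv) $c_jb_i-c_ib_i$ for $j>i$. **Algebras of type $R_{\mathfrak F}$.** Let $C$ be a $\Bbbk$-vector space of dimension $p$ with basis $c_1,\dots,c_p$, and let $\mathfrak F=\{V_1,W_1;\ldots;V_q,W_q\}$ be a family of subspaces of $C$ with $\dim V_i=\operatorname{codim}W_i=k_i$, $0\le k_q\le\cdots\le k_1\le p$. Property (G): $V_i\cap W_j=0$ for all $i\ge j$. For such a family, $R_{\mathfrak F}=\Bbbk Q_{p,q}/I_{\mathfrak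 F}$, where $I_{\mathfrak F}$ is generated by: 1) $b_icb_j$ for all $c\in C$ and $i\le j$; 2) $b_iv$ for all $v\in V_i$; 3) $wb_i$ for all $w\in W_i$. *)

theory Defs
  imports
    "HOL-Algebra.QuotRing"
    "HOL-Algebra.Module"
    "HOL-Library.Poly_Mapping"
    "Graph_Theory.Arc_Walk"
begin

section \<open>Finitely supported functions as a vector space\<close>

definition pm_scale :: "'k::field \<Rightarrow> ('a \<Rightarrow>\<^sub>0 'k) \<Rightarrow> ('a \<Rightarrow>\<^sub>0 'k)"
  where "pm_scale a f = Poly_Mapping.map ((*) a) f"

lemma lookup_pm_scale [simp]: "Poly_Mapping.lookup (pm_scale a f) x = a * Poly_Mapping.lookup f x"
  by (simp add: pm_scale_def Poly_Mapping.map.rep_eq when_def)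

interpretation pm: vector_space pm_scale
  by unfold_locales (auto intro!: poly_mapping_eqI simp: lookup_add algebra_simps)


section \<open>Path algebras\<close>

text \<open>
  A path from \<open>u\<close> to \<open>v\<close> is a triple \<open>(u, p, v)\<close> whose arrow list \<open>p\<close> is in order of
  traversal; \<open>(v, [], v)\<close> is the trivial path at \<open>v\<close>.  Paths are composed from right to left,
  so in \<open>x y\<close> the path \<open>y\<close> is traversed first.
\<close>

type_synonym ('v, 'e) path = "'v \<times> 'e list \<times> 'v"

definition paths :: "('v, 'e) pre_digraph \<Rightarrow> ('v, 'e) path set"
  where "paths Q = {(u, p, v). pre_digraph.awalk Q u p v}"

fun path_comp :: "('v, 'e) path \<Rightarrow> ('v, 'e) path \<Rightarrow> ('v, 'e) path option"
  where "path_comp (u, p, v) (w, q, z) = (if z = u then Some (w, q @ p, v) else None)"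

definition basis_mult :: "('v, 'e) path \<Rightarrow> ('v, 'e) path \<Rightarrow> 'k::field \<Rightarrow> (('v, 'e) path \<Rightarrow>\<^sub>0 'k)"
  where "basis_mult x y a =
    (case path_comp x y of None \<Rightarrow> 0 | Some z \<Rightarrow> Poly_Mapping.single z a)"

definition path_mult ::
    "(('v, 'e) path \<Rightarrow>\<^sub>0 'k::field) \<Rightarrow> (('v, 'e) path \<Rightarrow>\<^sub>0 'k) \<Rightarrow> (('v, 'e) path \<Rightarrow>\<^sub>0 'k)"
  where "path_mult f g =
    (\<Sum>x\<in>Poly_Mapping.keys f. \<Sum>y\<in>Poly_Mapping.keys g. basis_mult x y (Poly_Mapping.lookup f x * Poly_Mapping.lookup g y))"

text \<open>The unit is the sum of the trivial paths; this needs finitely many vertices.\<close>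

definition path_algebra :: "('v, 'e) pre_digraph \<Rightarrow> ('k::field, ('v, 'e) path \<Rightarrow>\<^sub>0 'k) module"
  where "path_algebra Q =
    \<lparr>carrier = {f. Poly_Mapping.keys f \<subseteq> paths Q},
     mult = path_mult,
     one = (\<Sum>v\<in>verts Q. Poly_Mapping.single (v, [], v) 1),
     zero = 0,
     add = (+),
     smult = pm_scale\<rparr>"

lemma path_mult_superset:
  assumes "finite A" "finite B" "Poly_Mapping.keys f \<subseteq> A" "Poly_Mapping.keys g \<subseteq> B"
  shows "path_mult f g = (\<Sum>x\<in>A. \<Sum>y\<in>B. basis_mult x y (Poly_Mapping.lookup f x * Poly_Mapping.lookup g y))"
proof -
  have z: "basis_mult x y 0 = 0" for x y :: "('a, 'b) path"
    by (auto simp: basis_mult_def split: option.split)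
  have "path_mult f g =
      (\<Sum>x\<in>Poly_Mapping.keys f. \<Sum>y\<in>B. basis_mult x y (Poly_Mapping.lookup f x * Poly_Mapping.lookup g y))"
    unfolding path_mult_def
    by (intro sum.cong refl sum.mono_neutral_left) (use assms in \<open>auto simp: z in_keys_iff\<close>)
  also have "\<dots> = (\<Sum>x\<in>A. \<Sum>y\<in>B. basis_mult x y (Poly_Mapping.lookup f x * Poly_Mapping.lookup g y))"
    by (intro sum.mono_neutral_left) (use assms in \<open>auto simp: z in_keys_iff\<close>)
  finally show ?thesis .
qed

lemma basis_mult_add: "basis_mult x y (a + b) = basis_mult x y a + basis_mult x y b"
  by (auto simp: basis_mult_def single_add split: option.split)

lemma path_mult_add_left: "path_mult (f + g) h = path_mult f h + path_mult g h"
proof -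
  let ?A = "Poly_Mapping.keys f \<union> Poly_Mapping.keys g" and ?B = "Poly_Mapping.keys h"
  have "Poly_Mapping.keys (f + g) \<subseteq> ?A" by (rule keys_add)
  then show ?thesis
    by (simp add: path_mult_superset[of ?A ?B] lookup_add distrib_right basis_mult_add sum.distrib)
qed

lemma path_mult_add_right: "path_mult h (f + g) = path_mult h f + path_mult h g"
proof -
  let ?A = "Poly_Mapping.keys f \<union> Poly_Mapping.keys g" and ?B = "Poly_Mapping.keys h"
  have "Poly_Mapping.keys (f + g) \<subseteq> ?A" by (rule keys_add)
  then show ?thesis
    by (simp add: path_mult_superset[of ?B ?A] lookup_add distrib_left basis_mult_add sum.distrib)
qed

lemma path_mult_zero [simp]: "path_mult 0 f = 0" "path_mult f 0 = 0"
  by (simp_all add: path_mult_def)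

lemma path_mult_sum_left: "path_mult (\<Sum>i\<in>I. f i) h = (\<Sum>i\<in>I. path_mult (f i) h)"
  by (induction I rule: infinite_finite_induct) (auto simp: path_mult_add_left)

lemma path_mult_sum_right: "path_mult h (\<Sum>i\<in>I. f i) = (\<Sum>i\<in>I. path_mult h (f i))"
  by (induction I rule: infinite_finite_induct) (auto simp: path_mult_add_right)

lemma path_mult_single:
  "path_mult (Poly_Mapping.single x a) (Poly_Mapping.single y b) = basis_mult x y (a * b)"
  by (subst path_mult_superset[of "{x}" "{y}"]) auto

lemma poly_mapping_sum_single:
  fixes f :: "'a \<Rightarrow>\<^sub>0 'k::field"
  shows "f = (\<Sum>x\<in>Poly_Mapping.keys f. Poly_Mapping.single x (Poly_Mapping.lookup f x))"
  by (rule poly_mapping_eqI)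
     (simp add: lookup_sum lookup_single when_def sum.delta' in_keys_iff)

lemma single_induct [consumes 1, case_names zero single add]:
  fixes f :: "'a \<Rightarrow>\<^sub>0 'k::field"
  assumes "Poly_Mapping.keys f \<subseteq> S"
    and "P 0" "\<And>x a. x \<in> S \<Longrightarrow> P (Poly_Mapping.single x a)"
    and "\<And>g h. P g \<Longrightarrow> P h \<Longrightarrow> P (g + h)"
  shows "P f"
proof -
  have "P (\<Sum>x\<in>A. Poly_Mapping.single x (Poly_Mapping.lookup f x))" if "finite A" "A \<subseteq> S" for A
    using that by (induction rule: finite_induct) (auto intro: assms)
  from this[of "Poly_Mapping.keys f"] show ?thesis
    using assms(1) poly_mapping_sum_single[of f] by simp
qed

lemma path_mult_assoc: "path_mult (path_mult f g) h = path_mult f (path_mult g h)"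
proof (induction f rule: single_induct[OF subset_UNIV])
  case (2 x a)
  show ?case
  proof (induction g rule: single_induct[OF subset_UNIV])
    case (2 y b)
    show ?case
    proof (induction h rule: single_induct[OF subset_UNIV])
      case (2 z c)
      show ?case
        by (cases x; cases y; cases z) (auto simp: path_mult_single basis_mult_def ac_simps)
    qed (auto simp: path_mult_add_right)
  qed (auto simp: path_mult_add_left path_mult_add_right)
qed (auto simp: path_mult_add_left)

lemma awalk_append:
  assumes "pre_digraph.awalk Q u p v" "pre_digraph.awalk Q v q w"
  shows "pre_digraph.awalk Q u (p @ q) w"
proof -
  have "pre_digraph.cas Q u (p @ q) w"
    if "pre_digraph.cas Q u p v" "pre_digraph.cas Q v q w" for u
    using that by (induction p arbitrary: u) (auto simp: pre_digraph.cas.simps)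
  then show ?thesis
    using assms by (auto simp: pre_digraph.awalk_def)
qed

lemma path_mult_closed:
  assumes "Poly_Mapping.keys f \<subseteq> paths Q" "Poly_Mapping.keys g \<subseteq> paths Q"
  shows "Poly_Mapping.keys (path_mult f g) \<subseteq> paths Q"
  using assms(1)
proof (induction f rule: single_induct)
  case (single x a)
  show ?case
    using assms(2)
  proof (induction g rule: single_induct)
    case (single y b)
    then show ?case
      using \<open>x \<in> paths Q\<close>
      by (cases x; cases y) (auto simp: path_mult_single basis_mult_def paths_def awalk_append)
  next
    case (add g h)
    then show ?case
      unfolding path_mult_add_right by (meson Un_least keys_add order_trans)
  qed auto
next
  case (add g h)
  then show ?case
    unfolding path_mult_add_left by (meson Un_least keys_add order_trans)
qed auto

lemma path_mult_one_left:
  assumes "finite (verts Q)" "Poly_Mapping.keys f \<subseteq> paths Q" "wf_digraph Q"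
  shows "path_mult (\<Sum>v\<in>verts Q. Poly_Mapping.single (v, [], v) 1) f = f"
  using assms(2)
proof (induction f rule: single_induct)
  case (single x a)
  obtain u p v where x: "x = (u, p, v)" by (cases x)
  have "v \<in> verts Q"
    if "pre_digraph.cas Q w p v" "set p \<subseteq> arcs Q" "w \<in> verts Q" for w
    using that
    by (induction p arbitrary: w)
       (auto simp: pre_digraph.cas.simps wf_digraph.head_in_verts[OF assms(3)])
  then have "v \<in> verts Q" using single x by (auto simp: paths_def pre_digraph.awalk_def)
  have "path_mult (\<Sum>v\<in>verts Q. Poly_Mapping.single (v, [], v) 1) (Poly_Mapping.single x a)
      = (\<Sum>w\<in>verts Q. if v = w then Poly_Mapping.single x a else 0)"
    unfolding path_mult_sum_left
    by (intro sum.cong) (auto simp: path_mult_single basis_mult_def x)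
  then show ?case using \<open>v \<in> verts Q\<close> assms by simp
qed (auto simp: path_mult_add_right)

lemma path_mult_one_right:
  assumes "finite (verts Q)" "Poly_Mapping.keys f \<subseteq> paths Q"
  shows "path_mult f (\<Sum>v\<in>verts Q. Poly_Mapping.single (v, [], v) 1) = f"
  using assms(2)
proof (induction f rule: single_induct)
  case (single x a)
  obtain u p v where x: "x = (u, p, v)" by (cases x)
  have "u \<in> verts Q" using single x by (auto simp: paths_def pre_digraph.awalk_def)
  have "path_mult (Poly_Mapping.single x a) (\<Sum>v\<in>verts Q. Poly_Mapping.single (v, [], v) 1)
      = (\<Sum>w\<in>verts Q. if u = w then Poly_Mapping.single x a else 0)"
    unfolding path_mult_sum_right
    by (intro sum.cong) (auto simp: path_mult_single basis_mult_def x)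
  then show ?case using \<open>u \<in> verts Q\<close> assms by simp
qed (auto simp: path_mult_add_left)

theorem ring_path_algebra:
  fixes Q :: "('v, 'e) pre_digraph"
  assumes "finite (verts Q)" "wf_digraph Q"
  shows "ring (path_algebra Q :: ('k::field, ('v, 'e) path \<Rightarrow>\<^sub>0 'k) module)"
proof -
  let ?A = "path_algebra Q :: ('k, ('v, 'e) path \<Rightarrow>\<^sub>0 'k) module"
  have add: "Poly_Mapping.keys (f + g) \<subseteq> paths Q"
    if "Poly_Mapping.keys f \<subseteq> paths Q" "Poly_Mapping.keys g \<subseteq> paths Q"
    for f g :: "('v, 'e) path \<Rightarrow>\<^sub>0 'k"
    using that by (meson Un_least keys_add order_trans)
  have one: "Poly_Mapping.keys (\<Sum>v\<in>V. Poly_Mapping.single (v, [], v) (1::'k)) \<subseteq> paths Q"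
    if "V \<subseteq> verts Q" for V
    using finite_subset[OF that assms(1)] that
  proof (induction V rule: finite_induct)
    case (insert v V)
    then have "(v, [], v) \<in> paths Q"
      by (auto simp: paths_def pre_digraph.awalk_def pre_digraph.cas.simps)
    then show ?case using insert by (simp add: add)
  qed auto
  show ?thesis
  proof (rule ringI)
    show "abelian_group ?A"
    proof (rule abelian_groupI)
      fix x assume "x \<in> carrier ?A"
      then have "- x \<in> carrier ?A" "- x \<oplus>\<^bsub>?A\<^esub> x = \<zero>\<^bsub>?A\<^esub>"
        by (auto simp: path_algebra_def in_keys_iff subset_iff)
      then show "\<exists>y\<in>carrier ?A. y \<oplus>\<^bsub>?A\<^esub> x = \<zero>\<^bsub>?A\<^esub>" by blast
    qed (simp_all add: path_algebra_def add add_ac)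
    show "monoid ?A"
      by (rule monoidI)
         (simp_all add: path_algebra_def path_mult_closed path_mult_assoc one
            path_mult_one_left path_mult_one_right assms)
  qed (simp_all add: path_algebra_def path_mult_add_left path_mult_add_right)
qed


section \<open>Quotients and isomorphisms of algebras\<close>

text \<open>The quotient ring of \<open>A\<close> by a two-sided ideal \<open>I\<close>, with the induced scalar multiplication.\<close>

definition quot_algebra :: "('k, 'a) module \<Rightarrow> 'a set \<Rightarrow> ('k, 'a set) module"
  where "quot_algebra A I =
    ring.extend (A Quot I) (module.fields (\<lambda>a X. \<Union>x\<in>X. I +>\<^bsub>A\<^esub> (a \<odot>\<^bsub>A\<^esub> x)))"

definition algebra_iso :: "('k, 'a) module \<Rightarrow> ('k, 'b) module \<Rightarrow> ('a \<Rightarrow> 'b) set"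
  where "algebra_iso A B =
    {h \<in> ring_iso A B. \<forall>a. \<forall>x\<in>carrier A. h (a \<odot>\<^bsub>A\<^esub> x) = a \<odot>\<^bsub>B\<^esub> h x}"

definition algebra_isomorphic :: "('k, 'a) module \<Rightarrow> ('k, 'b) module \<Rightarrow> bool"
  where "algebra_isomorphic A B \<longleftrightarrow> algebra_iso A B \<noteq> {}"


section \<open>The quiver with two vertices and its algebras\<close>

datatype arrow = CArrow nat | BArrow nat

definition two_quiver :: "nat \<Rightarrow> nat \<Rightarrow> (nat, arrow) pre_digraph"
  where "two_quiver p q =
    \<lparr>verts = {1, 2},
     arcs = CArrow ` {1..p} \<union> BArrow ` {1..q},
     tail = (\<lambda>e. case e of CArrow _ \<Rightarrow> 1 | BArrow _ \<Rightarrow> 2),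
     head = (\<lambda>e. case e of CArrow _ \<Rightarrow> 2 | BArrow _ \<Rightarrow> 1)\<rparr>"

lemma ring_path_algebra_two_quiver:
  "ring (path_algebra (two_quiver p q) :: ('k::field, (nat, arrow) path \<Rightarrow>\<^sub>0 'k) module)"
  by (rule ring_path_algebra)
     (auto simp: two_quiver_def wf_digraph_def split: arrow.split)

type_synonym 'k elt = "(nat, arrow) path \<Rightarrow>\<^sub>0 'k"

definition arr_c :: "nat \<Rightarrow> 'k::field elt"
  where "arr_c i = Poly_Mapping.single (1, [CArrow i], 2) 1"

definition arr_b :: "nat \<Rightarrow> 'k::field elt"
  where "arr_b i = Poly_Mapping.single (2, [BArrow i], 1) 1"

text \<open>
  The vector space \<open>C\<close> with basis \<open>c\<^sub>1, \<dots>, c\<^sub>p\<close> is realised inside the path algebra, as the span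
  of the arrows from 1 to 2.
\<close>

definition C_space :: "nat \<Rightarrow> 'k::field elt set"
  where "C_space p = pm.span (arr_c ` {1..p})"

definition KK_relations :: "nat \<Rightarrow> 'k::field elt set"
  where "KK_relations n =
    (let A = path_algebra (two_quiver n n) in
      {arr_b i \<otimes>\<^bsub>A\<^esub> x \<otimes>\<^bsub>A\<^esub> arr_b j | i x j. x \<in> C_space n \<and> i \<in> {1..n} \<and> j \<in> {1..n}} \<union>
      {arr_b i \<otimes>\<^bsub>A\<^esub> arr_c i | i. i \<in> {1..n}} \<union>
      {arr_c j \<otimes>\<^bsub>A\<^esub> arr_b i | i j. i \<in> {1..n} \<and> j \<in> {1..n} \<and> j < i} \<union>
      {arr_c j \<otimes>\<^bsub>A\<^esub> arr_b i - arr_c i \<otimes>\<^bsub>A\<^esub> arr_b i | i j. i \<in> {1..n} \<and> j \<in> {1..n} \<and> j > i})"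

definition KK :: "nat \<Rightarrow> ('k::field, 'k elt set) module"
  where "KK n =
    (let A = path_algebra (two_quiver n n) in quot_algebra A (Idl\<^bsub>A\<^esub> (KK_relations n)))"

text \<open>Codimension in the finite-dimensional space \<open>C\<close>; only used for subspaces of \<open>C\<close>.\<close>

definition codim_C :: "nat \<Rightarrow> 'k::field elt set \<Rightarrow> nat"
  where "codim_C p U = pm.dim (C_space p :: 'k elt set) - pm.dim U"

definition subspace_family ::
    "nat \<Rightarrow> nat \<Rightarrow> (nat \<Rightarrow> 'k::field elt set) \<Rightarrow> (nat \<Rightarrow> 'k elt set) \<Rightarrow> bool"
  where "subspace_family p q V W \<longleftrightarrow>
    (\<forall>i\<in>{1..q}. pm.subspace (V i) \<and> V i \<subseteq> C_space p \<and> pm.subspace (W i) \<and> W i \<subseteq> C_space p) \<and>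
    (\<exists>k :: nat \<Rightarrow> nat.
      (\<forall>i\<in>{1..q}. pm.dim (V i) = k i \<and> codim_C p (W i) = k i \<and> k i \<le> p) \<and>
      (\<forall>i\<in>{1..q}. \<forall>j\<in>{1..q}. i \<le> j \<longrightarrow> k j \<le> k i))"

definition property_G ::
    "nat \<Rightarrow> (nat \<Rightarrow> 'k::field elt set) \<Rightarrow> (nat \<Rightarrow> 'k elt set) \<Rightarrow> bool"
  where "property_G q V W \<longleftrightarrow> (\<forall>i\<in>{1..q}. \<forall>j\<in>{1..q}. i \<ge> j \<longrightarrow> V i \<inter> W j = {0})"

definition R_relations ::
    "nat \<Rightarrow> nat \<Rightarrow> (nat \<Rightarrow> 'k::field elt set) \<Rightarrow> (nat \<Rightarrow> 'k elt set) \<Rightarrow> 'k elt set"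
  where "R_relations p q V W =
    (let A = path_algebra (two_quiver p q) in
      {arr_b i \<otimes>\<^bsub>A\<^esub> x \<otimes>\<^bsub>A\<^esub> arr_b j | i x j. x \<in> C_space p \<and> i \<in> {1..q} \<and> j \<in> {1..q} \<and> i \<le> j} \<union>
      {arr_b i \<otimes>\<^bsub>A\<^esub> v | i v. i \<in> {1..q} \<and> v \<in> V i} \<union>
      {w \<otimes>\<^bsub>A\<^esub> arr_b i | i w. i \<in> {1..q} \<and> w \<in> W i})"

definition R_algebra ::
    "nat \<Rightarrow> nat \<Rightarrow> (nat \<Rightarrow> 'k::field elt set) \<Rightarrow> (nat \<Rightarrow> 'k elt set) \<Rightarrow> ('k, 'k elt set) module"
  where "R_algebra p q V W =
    (let A = path_algebra (two_quiver p q) in quot_algebra A (Idl\<^bsub>A\<^esub> (R_relations p q V W)))"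

end

theory Submission
  imports Defs
begin

text \<open>
  Both algebras are quotients of the same path algebra, and the two ideals coincide.  Writing
  \<open>f\<^sub>j\<close> for the functional on \<open>C\<close> with \<open>f\<^sub>j(c\<^sub>k) = 1\<close> for \<open>k \<ge> j\<close> and \<open>f\<^sub>j(c\<^sub>k) = 0\<close> for
  \<open>k < j\<close>, one has \<open>W\<^sub>j = ker f\<^sub>j\<close>, and \<open>f\<^sub>j(c\<^sub>i) = 1\<close> whenever \<open>i \<ge> j\<close>; this gives Property (G)
  and \<open>C = V\<^sub>i + W\<^sub>j\<close>.  The only relations of \<open>KK\<^sub>n\<close> that are not visibly among those of the
  family are \<open>b\<^sub>i c b\<^sub>j\<close> with \<open>i > j\<close>, and for these one splits \<open>c = v + w\<close> with \<open>v \<in> V\<^sub>i\<close> and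
  \<open>w \<in> W\<^sub>j\<close>, so that \<open>b\<^sub>i v = 0\<close> and \<open>w b\<^sub>j = 0\<close>.
\<close>

section \<open>Scalars in path algebras, and ideals as linear subspaces\<close>

lemma path_algebra_simps [simp]:
  "carrier (path_algebra Q) = {f. Poly_Mapping.keys f \<subseteq> paths Q}"
  "x \<otimes>\<^bsub>path_algebra Q\<^esub> y = path_mult x y"
  "x \<oplus>\<^bsub>path_algebra Q\<^esub> y = x + y"
  "\<zero>\<^bsub>path_algebra Q\<^esub> = 0"
  by (simp_all add: path_algebra_def)

lemma pm_scale_single [simp]:
  "pm_scale a (Poly_Mapping.single x b) = Poly_Mapping.single x (a * b)"
  by (rule poly_mapping_eqI) (simp add: lookup_single when_def)

lemma keys_pm_scale: "Poly_Mapping.keys (pm_scale a f) \<subseteq> Poly_Mapping.keys f"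
  by (auto simp: in_keys_iff)

lemma basis_mult_scale: "basis_mult x y (a * b) = pm_scale a (basis_mult x y b)"
  by (auto simp: basis_mult_def split: option.split)

lemma path_mult_scale_left: "path_mult (pm_scale a f) g = pm_scale a (path_mult f g)"
  by (subst path_mult_superset[OF finite_keys finite_keys keys_pm_scale order_refl])
     (simp add: path_mult_def mult.assoc basis_mult_scale pm.scale_sum_right)

lemma path_mult_scale_right: "path_mult f (pm_scale a g) = pm_scale a (path_mult f g)"
  by (subst path_mult_superset[OF finite_keys finite_keys order_refl keys_pm_scale])
     (simp add: path_mult_def mult.left_commute basis_mult_scale pm.scale_sum_right)

lemma path_mult_diff_left: "path_mult (f - g) h = path_mult f h - path_mult g h"
  using path_mult_add_left[of "f - g" g h] by (simp add: algebra_simps)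

text \<open>Scaling is multiplication by a ring element: \<open>a x = (a 1) x\<close>, and the
  scaled unit lies in the path algebra. Hence ideals in the ring sense absorb scalars, and the
  ring-theoretic \<open>Idl\<close> can be treated with linear algebra.\<close>

lemma subspace_ideal_path_algebra:
  assumes "finite (verts Q)" "wf_digraph Q" "ideal I (path_algebra Q)"
  shows "pm.subspace I"
proof (rule pm.subspaceI)
  let ?A = "path_algebra Q"
  interpret ideal I ?A by fact
  show "0 \<in> I"
    using additive_subgroup.zero_closed[OF ideal.axioms(1)[OF assms(3)]] by simp
  show "x + y \<in> I" if "x \<in> I" "y \<in> I" for x y
    using additive_subgroup.a_closed[OF ideal.axioms(1)[OF assms(3)] that] by simp
  show "pm_scale a x \<in> I" if "x \<in> I" for a x
  proof -
    have "x \<in> carrier ?A" using that a_subset by blast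
    have "pm_scale a \<one>\<^bsub>?A\<^esub> \<in> carrier ?A"
      using one_closed keys_pm_scale[of a "\<one>\<^bsub>?A\<^esub>"] by auto
    from I_l_closed[OF that this] have "pm_scale a (\<one>\<^bsub>?A\<^esub> \<otimes>\<^bsub>?A\<^esub> x) \<in> I"
      by (simp add: path_mult_scale_left)
    then show ?thesis
      using l_one[OF \<open>x \<in> carrier ?A\<close>] by simp
  qed
qed

text \<open>Relations that range over a whole subspace can thus be checked on a spanning set; the
  next lemma is the mirror image for the right factor.\<close>

lemma path_mult_span_left:
  assumes "pm.subspace I" "x \<in> pm.span S" "\<And>s. s \<in> S \<Longrightarrow> path_mult s y \<in> I"
  shows "path_mult x y \<in> I"
proof -
  have "pm.subspace {x. path_mult x y \<in> I}"
    using assms(1) by (auto simp: pm.subspace_def path_mult_add_left path_mult_scale_left)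
  from pm.span_minimal[OF _ this, of S] show ?thesis
    using assms(2,3) by blast
qed

lemma path_mult_span_right:
  assumes "pm.subspace I" "y \<in> pm.span S" "\<And>s. s \<in> S \<Longrightarrow> path_mult x s \<in> I"
  shows "path_mult x y \<in> I"
proof -
  have "pm.subspace {y. path_mult x y \<in> I}"
    using assms(1) by (auto simp: pm.subspace_def path_mult_add_right path_mult_scale_right)
  from pm.span_minimal[OF _ this, of S] show ?thesis
    using assms(2,3) by blast
qed

lemma subspace_ideal_two_quiver:
  "ideal I (path_algebra (two_quiver p q)) \<Longrightarrow> pm.subspace I"
  by (rule subspace_ideal_path_algebra)
     (auto simp: two_quiver_def wf_digraph_def split: arrow.split)

section \<open>The arrows and the space \<open>C\<close>\<close>

lemma arr_c_closed: "i \<in> {1..p} \<Longrightarrow> arr_c i \<in> carrier (path_algebra (two_quiver p q))"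
  by (auto simp: arr_c_def paths_def pre_digraph.awalk_def two_quiver_def pre_digraph.cas.simps)

lemma arr_b_closed: "i \<in> {1..q} \<Longrightarrow> arr_b i \<in> carrier (path_algebra (two_quiver p q))"
  by (auto simp: arr_b_def paths_def pre_digraph.awalk_def two_quiver_def pre_digraph.cas.simps)

lemma C_space_closed: "C_space p \<subseteq> carrier (path_algebra (two_quiver p q))"
proof -
  \<comment> \<open>The whole algebra is an ideal of itself, so the subspace property of ideals
    applies to its carrier.\<close>
  have "pm.subspace (carrier (path_algebra (two_quiver p q)) :: 'k::field elt set)"
    by (rule subspace_ideal_two_quiver, rule ring.oneideal, rule ring_path_algebra_two_quiver)
  then show ?thesis
    unfolding C_space_def by (rule pm.span_minimal[rotated]) (use arr_c_closed in blast)
qed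

text \<open>The start vertex is written \<open>Suc 0\<close> because the simplifier turns
  \<open>1 :: nat\<close> into this form.\<close>

lemma lookup_arr_c: "Poly_Mapping.lookup (arr_c i) (Suc 0, [CArrow j], 2) = (if i = j then 1 else 0)"
  by (auto simp: arr_c_def lookup_single when_def)

lemma inj_arr_c: "inj (arr_c :: nat \<Rightarrow> 'k::field elt)"
proof (rule injI)
  fix i j assume "arr_c i = (arr_c j :: 'k elt)"
  then have "Poly_Mapping.lookup (arr_c j :: 'k elt) (1, [CArrow i], 2) = 1"
    using lookup_arr_c[of i i, where ?'a = 'k] by simp
  then show "i = j" by (auto simp: lookup_arr_c split: if_splits)
qed

lemma independent_arr_c: "pm.independent (arr_c ` {1..p} :: 'k::field elt set)"
proof
  assume "pm.dependent (arr_c ` {1..p} :: 'k elt set)"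
  then obtain u where u: "(\<Sum>v\<in>arr_c ` {1..p}. pm_scale (u v) v) = (0 :: 'k elt)"
    and "\<exists>v\<in>arr_c ` {1..p}. u v \<noteq> 0"
    by (auto simp: pm.dependent_finite)
  then obtain j where j: "j \<in> {1..p}" "u (arr_c j) \<noteq> 0" by blast
  \<comment> \<open>Reading off the coefficient at the path that consists of \<open>CArrow j\<close>
    alone isolates \<open>u (arr_c j)\<close> in the vanishing combination.\<close>
  have "0 = Poly_Mapping.lookup (\<Sum>i\<in>{1..p}. pm_scale (u (arr_c i)) (arr_c i)) (1, [CArrow j], 2)"
    using u by (simp add: sum.reindex inj_on_subset[OF inj_arr_c])
  also have "\<dots> = (\<Sum>i\<in>{1..p}. if i = j then u (arr_c i) else 0)"
    unfolding lookup_sum by (rule sum.cong) (auto simp: lookup_arr_c)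
  also have "\<dots> = u (arr_c j)" using j(1) by simp
  finally show False using j(2) by simp
qed

lemma dim_C_space: "pm.dim (C_space p :: 'k::field elt set) = p"
  unfolding C_space_def pm.dim_span pm.dim_eq_card_independent[OF independent_arr_c]
  by (simp add: card_image inj_on_subset[OF inj_arr_c])

section \<open>Equality of generated ideals, and reflexivity of isomorphism\<close>

lemma genideal_eqI:
  assumes "ring R" "S \<subseteq> carrier R" "T \<subseteq> carrier R" "S \<subseteq> Idl\<^bsub>R\<^esub> T" "T \<subseteq> Idl\<^bsub>R\<^esub> S"
  shows "Idl\<^bsub>R\<^esub> S = Idl\<^bsub>R\<^esub> T"
  using assms by (intro equalityI ring.genideal_minimal ring.genideal_ideal)

lemma algebra_isomorphic_refl: "algebra_isomorphic A A"
proof -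
  have "id \<in> algebra_iso A A"
    by (simp add: algebra_iso_def ring_iso_def ring_hom_def)
  then show ?thesis unfolding algebra_isomorphic_def by blast
qed

section \<open>The subspaces \<open>W\<^sub>i\<close>: generators, dimension, and position relative
  to the \<open>V\<^sub>i\<close>\<close>

definition W_gens :: "nat \<Rightarrow> nat \<Rightarrow> 'k::field elt set"
  where "W_gens n i = arr_c ` {1..<i} \<union> (\<lambda>j. arr_c j - arr_c i) ` {i<..n}"

lemma W_gens_subset_C: "i \<in> {1..n} \<Longrightarrow> W_gens n i \<subseteq> C_space n"
  unfolding W_gens_def C_space_def
  by (auto intro!: pm.span_diff intro: pm.span_base)

text \<open>Adjoining the single vector \<open>c\<^sub>i\<close> recovers all of \<open>C\<close>,
  since \<open>c\<^sub>k = (c\<^sub>k - c\<^sub>i) + c\<^sub>i\<close> for \<open>k > i\<close>.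
  This bounds the dimension of \<open>W\<^sub>i\<close> from below.\<close>

lemma arr_c_in_span_W_gens:
  assumes "k \<in> {1..n}"
  shows "arr_c k \<in> pm.span (insert (arr_c i) (W_gens n i))"
proof -
  consider "k < i" | "k = i" | "k > i" by linarith
  then show ?thesis
  proof cases
    case 3
    then have "(arr_c k - arr_c i) + arr_c i \<in> pm.span (insert (arr_c i) (W_gens n i))"
      using assms by (intro pm.span_add pm.span_base) (auto simp: W_gens_def)
    then show ?thesis by simp
  qed (use assms in \<open>auto simp: W_gens_def intro: pm.span_base\<close>)
qed

text \<open>Counting generators gives the upper bound. For the lower bound, a basis \<open>B\<close>
  enlarged by \<open>c\<^sub>i\<close> spans the \<open>n\<close> independent arrows, so
  \<open>n\<close> is at most \<open>card B + 1\<close>.\<close>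

lemma dim_W_gens:
  assumes "i \<in> {1..n}"
  shows "pm.dim (W_gens n i :: 'k::field elt set) = n - 1"
proof (rule antisym)
  let ?G = "W_gens n i :: 'k elt set"
  have fin: "finite ?G" by (simp add: W_gens_def)
  have "card ?G \<le> card {1..<i} + card {i<..n}"
    unfolding W_gens_def by (intro order_trans[OF card_Un_le] add_mono card_image_le) auto
  then have "card ?G \<le> n - 1" using assms by simp
  then show "pm.dim ?G \<le> n - 1"
    using pm.dim_le_card'[OF fin] by simp
  obtain B where B: "B \<subseteq> ?G" "pm.independent B" "?G \<subseteq> pm.span B" "card B = pm.dim ?G"
    using pm.basis_exists by blast
  have finB: "finite B" using B(1) fin finite_subset by blast
  have "insert (arr_c i) ?G \<subseteq> pm.span (insert (arr_c i) B)"
    using B(3) pm.span_mono[of B "insert (arr_c i) B"] by (auto intro: pm.span_base)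
  then have "pm.span (insert (arr_c i) ?G) \<subseteq> pm.span (insert (arr_c i) B)"
    by (simp add: pm.span_minimal)
  then have "arr_c ` {1..n} \<subseteq> pm.span (insert (arr_c i) B)"
    using arr_c_in_span_W_gens by blast
  then have "card (arr_c ` {1..n} :: 'k elt set) \<le> card (insert (arr_c i) B)"
    using pm.independent_span_bound[OF _ independent_arr_c] finB by blast
  also have "\<dots> \<le> Suc (card B)"
    using finB by (simp add: card_insert_if)
  finally show "n - 1 \<le> pm.dim ?G"
    using B(4) by (simp add: card_image inj_on_subset[OF inj_arr_c])
qed

lemma span_arr_c_Int_span_W_gens:
  assumes "i \<in> {1..n}" "j \<in> {1..n}" "j \<le> i"
  shows "pm.span {arr_c i} \<inter> pm.span (W_gens n j :: 'k::field elt set) = {0}"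
proof -
  \<comment> \<open>The functional \<open>f\<^sub>j\<close> of the overview, extended to all
    finitely supported functions by summing the coefficients at
    \<open>c\<^sub>j, \<dots>, c\<^sub>n\<close>. A difference \<open>c\<^sub>k - c\<^sub>j\<close>
    with \<open>k > j\<close> is killed because both terms have value 1.\<close>
  define f :: "'k elt \<Rightarrow> 'k"
    where "f x = (\<Sum>k\<in>{j..n}. Poly_Mapping.lookup x (1, [CArrow k], 2))" for x
  have f_arr: "f (arr_c k) = (if k \<in> {j..n} then 1 else 0)" for k
    by (simp add: f_def lookup_arr_c)
  have f_diff: "f (x - y) = f x - f y" for x y
    by (simp add: f_def lookup_minus sum_subtractf)
  have "pm.subspace {x. f x = 0}"
    by (auto simp: pm.subspace_def f_def lookup_add sum.distrib simp flip: sum_distrib_left)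
  moreover have "W_gens n j \<subseteq> {x. f x = 0}"
    using assms by (auto simp: W_gens_def f_diff f_arr)
  ultimately have ker: "pm.span (W_gens n j) \<subseteq> {x. f x = 0}"
    by (rule pm.span_minimal[rotated])
  have "x = 0" if x: "x \<in> pm.span {arr_c i}" "x \<in> pm.span (W_gens n j)" for x :: "'k elt"
  proof -
    obtain a where a: "x = pm_scale a (arr_c i)"
      using x(1) by (auto simp: pm.span_singleton)
    have "f x = a * f (arr_c i)"
      by (simp add: a f_def sum_distrib_left)
    \<comment> \<open>Since \<open>j \<le> i \<le> n\<close>, the value \<open>f (arr_c i)\<close>
      is 1, so membership in the kernel forces \<open>a = 0\<close>.\<close>
    then show "x = 0" using ker x(2) assms by (auto simp: a f_arr)
  qed
  then show ?thesis by (auto simp: pm.span_zero)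
qed

text \<open>This is \<open>C = V\<^sub>i + W\<^sub>j\<close> on basis vectors. For
  \<open>k < j\<close> the arrow already lies in \<open>W\<^sub>j\<close>; otherwise
  \<open>c\<^sub>k = c\<^sub>i + (c\<^sub>k - c\<^sub>i)\<close>, where the bracket is the
  difference of \<open>c\<^sub>k - c\<^sub>j\<close> and
  \<open>c\<^sub>i - c\<^sub>j\<close>.\<close>

lemma arr_c_decompose:
  assumes "i \<in> {1..n}" "j \<in> {1..n}" "j < i" "k \<in> {1..n}"
  obtains v w where "v \<in> pm.span {arr_c i}" "w \<in> pm.span (W_gens n j)" "arr_c k = v + w"
proof (cases "k < j")
  case True
  then have "arr_c k \<in> pm.span (W_gens n j)"
    using assms by (auto simp: W_gens_def intro: pm.span_base)
  then show ?thesis using that[of 0 "arr_c k"] by (simp add: pm.span_zero)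
next
  case False
  \<comment> \<open>The index \<open>l = j\<close> gives the zero vector, which is in the span
    although \<open>W_gens\<close> lists only larger indices.\<close>
  have *: "arr_c l - arr_c j \<in> pm.span (W_gens n j)" if "l \<in> {j..n}" for l
  proof (cases "l = j")
    case False
    then show ?thesis using that by (auto simp: W_gens_def intro!: pm.span_base)
  qed (simp add: pm.span_zero)
  have "(arr_c k - arr_c j) - (arr_c i - arr_c j) \<in> pm.span (W_gens n j)"
    using assms False by (intro pm.span_diff *) auto
  then have "arr_c k - arr_c i \<in> pm.span (W_gens n j)" by simp
  then show ?thesis
    using that[of "arr_c i" "arr_c k - arr_c i"] by (simp add: pm.span_base)
qed

section \<open>The two sets of relations and the ideals that contain them\<close>

lemma KK_relations_closed:
  "KK_relations n \<subseteq> carrier (path_algebra (two_quiver n n) :: ('k::field, 'k elt) module)"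
proof -
  let ?A = "path_algebra (two_quiver n n) :: ('k, 'k elt) module"
  interpret ring ?A by (rule ring_path_algebra_two_quiver)
  have diff: "x - y \<in> carrier ?A" if "x \<in> carrier ?A" "y \<in> carrier ?A" for x y
    using pm.subspace_diff[OF subspace_ideal_two_quiver[OF oneideal] that] .
  then show ?thesis
    using subsetD[OF C_space_closed[of n n]]
    unfolding KK_relations_def Let_def Un_subset_iff
    by (auto simp del: path_algebra_simps intro!: diff m_closed arr_b_closed arr_c_closed)
qed

lemma R_relations_closed:
  assumes "\<And>i. i \<in> {1..q} \<Longrightarrow> V i \<subseteq> C_space p" "\<And>i. i \<in> {1..q} \<Longrightarrow> W i \<subseteq> C_space p"
  shows "R_relations p q V W \<subseteq> carrier (path_algebra (two_quiver p q) :: ('k::field, 'k elt) module)"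
proof -
  let ?A = "path_algebra (two_quiver p q) :: ('k, 'k elt) module"
  interpret ring ?A by (rule ring_path_algebra_two_quiver)
  show ?thesis
    using subsetD[OF C_space_closed[of p q]] subsetD[OF assms(1)] subsetD[OF assms(2)]
    unfolding R_relations_def Let_def Un_subset_iff
    by (auto simp del: path_algebra_simps intro!: m_closed arr_b_closed)
qed

text \<open>One conjunct per family of relations, for use with an arbitrary \<open>I\<close>.
  Factoring the last family as \<open>(c\<^sub>j - c\<^sub>i) b\<^sub>i\<close> exposes the
  generators of \<open>W\<^sub>i\<close> as left factors, just as the third family does.\<close>

lemma KK_relations_subset_iff:
  "KK_relations n \<subseteq> I \<longleftrightarrow>
    (\<forall>x\<in>C_space n. \<forall>i\<in>{1..n}. \<forall>j\<in>{1..n}. path_mult (path_mult (arr_b i) x) (arr_b j) \<in> I) \<and>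
    (\<forall>i\<in>{1..n}. path_mult (arr_b i) (arr_c i) \<in> I) \<and>
    (\<forall>i\<in>{1..n}. \<forall>j\<in>{1..n}. j < i \<longrightarrow> path_mult (arr_c j) (arr_b i) \<in> I) \<and>
    (\<forall>i\<in>{1..n}. \<forall>j\<in>{1..n}. j > i \<longrightarrow> path_mult (arr_c j - arr_c i) (arr_b i) \<in> I)"
  unfolding KK_relations_def Let_def Un_subset_iff path_mult_diff_left path_algebra_simps conj_assoc
  by (intro arg_cong2[of _ _ _ _ "(\<and>)"]; fast)

lemma R_relations_subset_iff:
  "R_relations p q V W \<subseteq> I \<longleftrightarrow>
    (\<forall>x\<in>C_space p. \<forall>i\<in>{1..q}. \<forall>j\<in>{1..q}. i \<le> j \<longrightarrow>
      path_mult (path_mult (arr_b i) x) (arr_b j) \<in> I) \<and>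
    (\<forall>i\<in>{1..q}. \<forall>v\<in>V i. path_mult (arr_b i) v \<in> I) \<and>
    (\<forall>i\<in>{1..q}. \<forall>w\<in>W i. path_mult w (arr_b i) \<in> I)"
  unfolding R_relations_def Let_def Un_subset_iff path_algebra_simps conj_assoc
  by (intro arg_cong2[of _ _ _ _ "(\<and>)"]; fast)

text \<open>The relations \<open>b\<^sub>i c b\<^sub>j\<close> with \<open>i \<le> j\<close> are
  among those of \<open>KK\<^sub>n\<close>; the other two families follow by linearity from the
  generators of \<open>V\<^sub>i\<close> and \<open>W\<^sub>i\<close>.\<close>

lemma R_relations_subset_ideal:
  fixes V W :: "nat \<Rightarrow> 'k::field elt set"
  assumes V: "\<And>i. i \<in> {1..n} \<Longrightarrow> V i = pm.span {arr_c i}"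
    and W: "\<And>i. i \<in> {1..n} \<Longrightarrow> W i = pm.span (W_gens n i)"
    and I: "ideal I (path_algebra (two_quiver n n))" "KK_relations n \<subseteq> I"
  shows "R_relations n n V W \<subseteq> I"
proof -
  note sub = subspace_ideal_two_quiver[OF I(1)]
  have bcb: "path_mult (path_mult (arr_b i) x) (arr_b j) \<in> I"
    if "x \<in> C_space n" "i \<in> {1..n}" "j \<in> {1..n}" for i x j
    using I(2) that unfolding KK_relations_subset_iff by blast
  have bc: "path_mult (arr_b i) (arr_c i) \<in> I" if "i \<in> {1..n}" for i
    using I(2) that unfolding KK_relations_subset_iff by blast
  have cb: "path_mult (arr_c j) (arr_b i) \<in> I" if "i \<in> {1..n}" "j \<in> {1..n}" "j < i" for i j
    using I(2) that unfolding KK_relations_subset_iff by blast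
  have cb_diff: "path_mult (arr_c j - arr_c i) (arr_b i) \<in> I"
    if "i \<in> {1..n}" "j \<in> {1..n}" "j > i" for i j
    using I(2) that unfolding KK_relations_subset_iff by blast
  have bv: "path_mult (arr_b i) v \<in> I" if "i \<in> {1..n}" "v \<in> V i" for i v
    using path_mult_span_right[OF sub] bc that V by blast
  have wb: "path_mult w (arr_b i) \<in> I" if i: "i \<in> {1..n}" and w: "w \<in> W i" for i w
  proof (rule path_mult_span_left[OF sub])
    show "w \<in> pm.span (W_gens n i)" using W i w by simp
    show "path_mult s (arr_b i) \<in> I" if "s \<in> W_gens n i" for s
      using that i unfolding W_gens_def by (auto intro!: cb cb_diff)
  qed
  show ?thesis
    unfolding R_relations_subset_iff using bcb bv wb by blast
qed

lemma KK_relations_subset_ideal: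
  fixes V W :: "nat \<Rightarrow> 'k::field elt set"
  assumes V: "\<And>i. i \<in> {1..n} \<Longrightarrow> V i = pm.span {arr_c i}"
    and W: "\<And>i. i \<in> {1..n} \<Longrightarrow> W i = pm.span (W_gens n i)"
    and I: "ideal I (path_algebra (two_quiver n n))" "R_relations n n V W \<subseteq> I"
  shows "KK_relations n \<subseteq> I"
proof -
  interpret ideal I "path_algebra (two_quiver n n)" by (rule I(1))
  note sub = subspace_ideal_two_quiver[OF I(1)]
  have bcb_le: "path_mult (path_mult (arr_b i) x) (arr_b j) \<in> I"
    if "x \<in> C_space n" "i \<in> {1..n}" "j \<in> {1..n}" "i \<le> j" for i x j
    using I(2) that unfolding R_relations_subset_iff by blast
  have bv: "path_mult (arr_b i) v \<in> I" if "i \<in> {1..n}" "v \<in> pm.span {arr_c i}" for i v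
    using I(2) that(1) that(2)[folded V[OF that(1)]] unfolding R_relations_subset_iff by blast
  have wb: "path_mult w (arr_b i) \<in> I" if "i \<in> {1..n}" "w \<in> pm.span (W_gens n i)" for i w
    using I(2) that(1) that(2)[folded W[OF that(1)]] unfolding R_relations_subset_iff by blast
  have bcb_gt: "path_mult (path_mult (arr_b i) x) (arr_b j) \<in> I"
    if x: "x \<in> C_space n" and ij: "i \<in> {1..n}" "j \<in> {1..n}" "j < i" for i x j
  proof -
    \<comment> \<open>The condition is linear in \<open>x\<close>, so it suffices to treat the basis
      arrows \<open>c\<^sub>k\<close>, which can be split.\<close>
    have subspace: "pm.subspace {x. path_mult (path_mult (arr_b i) x) (arr_b j) \<in> I}"
      using sub by (auto simp: pm.subspace_def path_mult_add_left path_mult_add_right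
          path_mult_scale_left path_mult_scale_right)
    have "path_mult (path_mult (arr_b i) (arr_c k)) (arr_b j) \<in> I" if "k \<in> {1..n}" for k
    proof -
      obtain v w :: "'k elt" where vw: "v \<in> pm.span {arr_c i}" "w \<in> pm.span (W_gens n j)"
        and k: "arr_c k = v + w"
        using arr_c_decompose[OF ij \<open>k \<in> {1..n}\<close>] .
      \<comment> \<open>The \<open>v\<close> part is \<open>b\<^sub>i v\<close> multiplied on the
        right by \<open>b\<^sub>j\<close>; the \<open>w\<close> part, after reassociation, is
        \<open>w b\<^sub>j\<close> multiplied on the left by \<open>b\<^sub>i\<close>.\<close>
      have "path_mult (path_mult (arr_b i) v) (arr_b j) \<in> I"
        using I_r_closed[OF bv[OF ij(1) vw(1)] arr_b_closed[OF ij(2)]] by simp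
      moreover have "path_mult (path_mult (arr_b i) w) (arr_b j) \<in> I"
        using I_l_closed[OF wb[OF ij(2) vw(2)] arr_b_closed[OF ij(1)]]
        by (simp add: path_mult_assoc)
      ultimately show ?thesis
        unfolding k path_mult_add_left path_mult_add_right by (rule pm.subspace_add[OF sub])
    qed
    then have "C_space n \<subseteq> {x. path_mult (path_mult (arr_b i) x) (arr_b j) \<in> I}"
      unfolding C_space_def by (intro pm.span_minimal subspace) auto
    then show ?thesis using x by auto
  qed
  have bcb: "path_mult (path_mult (arr_b i) x) (arr_b j) \<in> I"
    if "x \<in> C_space n" "i \<in> {1..n}" "j \<in> {1..n}" for i x j
    using bcb_le[OF that] bcb_gt[OF that] by linarith
  have bc: "path_mult (arr_b i) (arr_c i) \<in> I" if "i \<in> {1..n}" for i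
    using bv that by (simp add: pm.span_base)
  have cb: "path_mult (arr_c j) (arr_b i) \<in> I" if "i \<in> {1..n}" "j \<in> {1..n}" "j < i" for i j
    by (rule wb) (use that in \<open>auto simp: W_gens_def intro!: pm.span_base\<close>)
  have cb_diff: "path_mult (arr_c j - arr_c i) (arr_b i) \<in> I"
    if "i \<in> {1..n}" "j \<in> {1..n}" "j > i" for i j
    by (rule wb) (use that in \<open>auto simp: W_gens_def intro!: pm.span_base\<close>)
  show ?thesis
    unfolding KK_relations_subset_iff using bcb bc cb cb_diff by blast
qed

section \<open>The family and the comparison of the two quotients\<close>

theorem proposition3p3:
  fixes n :: nat
    and V W :: "nat \<Rightarrow> 'k::field elt set"
  assumes "infinite (UNIV :: 'k set)"
    and "n \<ge> 1"
    and "\<And>i. i \<in> {1..n} \<Longrightarrow> V i = pm.span {arr_c i}"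
    and "\<And>i. i \<in> {1..n} \<Longrightarrow> W i = pm.span (arr_c ` {1..<i} \<union> (\<lambda>j. arr_c j - arr_c i) ` {i<..n})"
  shows "subspace_family n n V W \<and> property_G n V W \<and>
    algebra_isomorphic (KK n :: ('k, 'k elt set) module) (R_algebra n n V W)"
proof (intro conjI)
  let ?A = "path_algebra (two_quiver n n) :: ('k, 'k elt) module"
  note V = assms(3)
  have W: "W i = pm.span (W_gens n i)" if "i \<in> {1..n}" for i
    using assms(4)[OF that] by (simp add: W_gens_def)
  have VC: "V i \<subseteq> C_space n" if "i \<in> {1..n}" for i
    unfolding V[OF that] C_space_def using that by (intro pm.span_mono) auto
  have WC: "W i \<subseteq> C_space n" if "i \<in> {1..n}" for i
    unfolding W[OF that] using W_gens_subset_C[OF that]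
    by (rule pm.span_minimal) (simp add: C_space_def pm.subspace_span)
  have dimV: "pm.dim (V i) = 1" if "i \<in> {1..n}" for i
  proof -
    have "pm.independent {arr_c i :: 'k elt}"
      by (rule pm.independent_mono[OF independent_arr_c[of n]]) (use that in auto)
    from pm.dim_eq_card_independent[OF this] show ?thesis
      by (simp add: V[OF that] pm.dim_span)
  qed
  \<comment> \<open>The truncated difference \<open>n - (n - 1)\<close> is 1 because an index in
    \<open>{1..n}\<close> forces \<open>n \<ge> 1\<close>.\<close>
  have codimW: "codim_C n (W i) = 1" if "i \<in> {1..n}" for i
    using that by (simp add: codim_C_def W[OF that] pm.dim_span dim_C_space dim_W_gens[OF that])
  show "subspace_family n n V W"
    unfolding subspace_family_def
  \<comment> \<open>All \<open>k\<^sub>i\<close> equal 1, so monotonicity is immediate and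
    \<open>k\<^sub>i \<le> n\<close> is the assumption \<open>n \<ge> 1\<close>.\<close>
  proof (intro conjI ballI exI[where x = "\<lambda>_. 1"])
    fix i assume i: "i \<in> {1..n}"
    show "pm.subspace (V i)" "pm.subspace (W i)"
      unfolding V[OF i] W[OF i] by (rule pm.subspace_span)+
  qed (use VC WC dimV codimW assms(2) in auto)
  show "property_G n V W"
    unfolding property_G_def
    by (intro ballI impI) (simp only: V W span_arr_c_Int_span_W_gens)
  have ringA: "ring ?A" by (rule ring_path_algebra_two_quiver)
  have closed: "KK_relations n \<subseteq> carrier ?A" "R_relations n n V W \<subseteq> carrier ?A"
    by (rule KK_relations_closed, rule R_relations_closed[OF VC WC])
  have "Idl\<^bsub>?A\<^esub> (KK_relations n) = Idl\<^bsub>?A\<^esub> (R_relations n n V W)"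
  proof (rule genideal_eqI[OF ringA closed])
    show "KK_relations n \<subseteq> Idl\<^bsub>?A\<^esub> (R_relations n n V W)"
      by (rule KK_relations_subset_ideal[OF V W ring.genideal_ideal[OF ringA closed(2)]
            ring.genideal_self[OF ringA closed(2)]])
    show "R_relations n n V W \<subseteq> Idl\<^bsub>?A\<^esub> (KK_relations n)"
      by (rule R_relations_subset_ideal[OF V W ring.genideal_ideal[OF ringA closed(1)]
            ring.genideal_self[OF ringA closed(1)]])
  qed
  \<comment> \<open>Equal ideals make the quotients literally the same structure, so the identity
    serves as the isomorphism.\<close>
  then have "KK n = R_algebra n n V W"
    by (simp only: KK_def R_algebra_def Let_def)
  then show "algebra_isomorphic (KK n :: ('k, 'k elt set) module) (R_algebra n n V W)"
    by (simp only: algebra_isomorphic_refl)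
qed

end
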